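(* Let $n\in\mathbb{N}$ with $n \geq 5$. The number of nilpotent semigroups of order $n$ and coclass $1$ \begin{enumerate} \item[(i)] counting up to (anti-)isomorphism equals $n+\lfloor n/2 \rfloor$; \item[(ii)] counting up to isomorphism equals $n+\lfloor n/2 \rfloor+2$; \item[(iii)] counting commutative semigroups up to isomorphism equals $n+\lfloor n/2 \rfloor-2$. \end{enumerate}
   Context: A semigroup $S$ is nilpotent if there exists $c\in\mathbb{N}_0$ with $|S^{c+1}|=1$, where $S^k$ denotes the set of all products of $k$ elements of $S$; the least such $c$ is the class of $S$. The coclass of a finite nilpotent semigroup $S$ of class $c$ is $|S|-1-c$. Two semigroups are anti-isomorphic if one is isomorphic to the dual (the semigroup with reversed multiplication) of the other. "Up to (anti-)isomorphism" means "up to isomorphism or anti-isomorphism". Item (iii) counts only the commutative semigroups among the nilpotent semigroups of order $n$ and coclass $1$. *)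

theory Defs
  imports Main
begin

text \<open>
  Semigroups are given by an explicit carrier \<open>S\<close> and a multiplication \<open>f\<close>
  of which only the values on \<open>S\<close> matter.
\<close>

definition semigroup_on :: "'a set \<Rightarrow> ('a \<Rightarrow> 'a \<Rightarrow> 'a) \<Rightarrow> bool" where
  "semigroup_on S f \<longleftrightarrow>
     (\<forall>x\<in>S. \<forall>y\<in>S. f x y \<in> S) \<and>
     (\<forall>x\<in>S. \<forall>y\<in>S. \<forall>z\<in>S. f (f x y) z = f x (f y z))"

definition commutative_on :: "'a set \<Rightarrow> ('a \<Rightarrow> 'a \<Rightarrow> 'a) \<Rightarrow> bool" where
  "commutative_on S f \<longleftrightarrow> (\<forall>x\<in>S. \<forall>y\<in>S. f x y = f y x)"

text \<open>
  \<open>S\<^sup>k\<close>, the set of all products of \<open>k\<close> elements of \<open>S\<close>.  It is only meaningful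
  for \<open>k \<ge> 1\<close>, and empty for \<open>k = 0\<close>.
\<close>

definition products :: "'a set \<Rightarrow> ('a \<Rightarrow> 'a \<Rightarrow> 'a) \<Rightarrow> nat \<Rightarrow> 'a set" where
  "products S f k = {foldl f x xs | x xs. x \<in> S \<and> set xs \<subseteq> S \<and> Suc (length xs) = k}"

definition nilpotent_on :: "'a set \<Rightarrow> ('a \<Rightarrow> 'a \<Rightarrow> 'a) \<Rightarrow> bool" where
  "nilpotent_on S f \<longleftrightarrow> (\<exists>c. card (products S f (c + 1)) = 1)"

definition nilpotency_class :: "'a set \<Rightarrow> ('a \<Rightarrow> 'a \<Rightarrow> 'a) \<Rightarrow> nat" where
  "nilpotency_class S f = (LEAST c. card (products S f (c + 1)) = 1)"

definition coclass :: "'a set \<Rightarrow> ('a \<Rightarrow> 'a \<Rightarrow> 'a) \<Rightarrow> int" where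
  "coclass S f = int (card S) - 1 - int (nilpotency_class S f)"

definition isomorphic ::
    "'a set \<Rightarrow> ('a \<Rightarrow> 'a \<Rightarrow> 'a) \<Rightarrow> 'b set \<Rightarrow> ('b \<Rightarrow> 'b \<Rightarrow> 'b) \<Rightarrow> bool" where
  "isomorphic S f T g \<longleftrightarrow>
     (\<exists>h. bij_betw h S T \<and> (\<forall>x\<in>S. \<forall>y\<in>S. h (f x y) = g (h x) (h y)))"

definition dual :: "('a \<Rightarrow> 'a \<Rightarrow> 'a) \<Rightarrow> 'a \<Rightarrow> 'a \<Rightarrow> 'a" where
  "dual f = (\<lambda>x y. f y x)"

definition anti_isomorphic ::
    "'a set \<Rightarrow> ('a \<Rightarrow> 'a \<Rightarrow> 'a) \<Rightarrow> 'b set \<Rightarrow> ('b \<Rightarrow> 'b \<Rightarrow> 'b) \<Rightarrow> bool" where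
  "anti_isomorphic S f T g \<longleftrightarrow> isomorphic S f T (dual g)"

text \<open>
  Every semigroup of order \<open>n\<close> is isomorphic to one with carrier \<open>{..<n}\<close>
  (see \<open>semigroup_transport\<close> below), so it suffices to count the multiplications
  on this carrier.
\<close>

definition nilpotent_semigroups :: "nat \<Rightarrow> int \<Rightarrow> (nat \<Rightarrow> nat \<Rightarrow> nat) set" where
  "nilpotent_semigroups n r =
     {f. semigroup_on {..<n} f \<and> nilpotent_on {..<n} f \<and> coclass {..<n} f = r}"

text \<open>
  The relations below ignore the values of a multiplication outside \<open>{..<n}\<close>.
  Hence two functions that agree on \<open>{..<n}\<close> lie in the same class, and no
  extensionality condition is needed in \<open>nilpotent_semigroups\<close>.
\<close>

definition iso_rel :: "nat \<Rightarrow> ((nat \<Rightarrow> nat \<Rightarrow> nat) \<times> (nat \<Rightarrow> nat \<Rightarrow> nat)) set" where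
  "iso_rel n = {(f, g). semigroup_on {..<n} f \<and> semigroup_on {..<n} g \<and>
     isomorphic {..<n} f {..<n} g}"

definition iso_anti_rel :: "nat \<Rightarrow> ((nat \<Rightarrow> nat \<Rightarrow> nat) \<times> (nat \<Rightarrow> nat \<Rightarrow> nat)) set" where
  "iso_anti_rel n = {(f, g). semigroup_on {..<n} f \<and> semigroup_on {..<n} g \<and>
     (isomorphic {..<n} f {..<n} g \<or> anti_isomorphic {..<n} f {..<n} g)}"

definition number_up_to :: "('a \<times> 'a) set \<Rightarrow> 'a set \<Rightarrow> nat" where
  "number_up_to R A = card (A // R)"

lemma isomorphic_refl: "isomorphic S f S f"
  unfolding isomorphic_def by (rule exI[of _ id]) auto

lemma isomorphic_sym:
  assumes "semigroup_on S f" "isomorphic S f T g"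
  shows "isomorphic T g S f"
proof -
  obtain h where h: "bij_betw h S T" "\<And>x y. x \<in> S \<Longrightarrow> y \<in> S \<Longrightarrow> h (f x y) = g (h x) (h y)"
    using assms(2) unfolding isomorphic_def by blast
  let ?k = "inv_into S h"
  have k: "bij_betw ?k T S"
    using h(1) by (rule bij_betw_inv_into)
  have "?k (g u v) = f (?k u) (?k v)" if "u \<in> T" "v \<in> T" for u v
  proof -
    have mem: "?k u \<in> S" "?k v \<in> S"
      using k that by (auto dest: bij_betwE)
    have "g u v = h (f (?k u) (?k v))"
      using h(2)[OF mem] h(1) that by (simp add: bij_betw_inv_into_right)
    moreover have "f (?k u) (?k v) \<in> S"
      using assms(1) mem unfolding semigroup_on_def by blast
    ultimately show ?thesis
      using h(1) by (simp add: bij_betw_inv_into_left)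
  qed
  with k show ?thesis
    unfolding isomorphic_def by blast
qed

lemma isomorphic_trans:
  assumes "isomorphic S f T g" "isomorphic T g U k"
  shows "isomorphic S f U k"
proof -
  obtain h where h: "bij_betw h S T" "\<And>x y. x \<in> S \<Longrightarrow> y \<in> S \<Longrightarrow> h (f x y) = g (h x) (h y)"
    using assms(1) unfolding isomorphic_def by blast
  obtain h' where h': "bij_betw h' T U" "\<And>x y. x \<in> T \<Longrightarrow> y \<in> T \<Longrightarrow> h' (g x y) = k (h' x) (h' y)"
    using assms(2) unfolding isomorphic_def by blast
  have "bij_betw (h' \<circ> h) S U"
    using h(1) h'(1) by (rule bij_betw_trans)
  moreover have "(h' \<circ> h) (f x y) = k ((h' \<circ> h) x) ((h' \<circ> h) y)" if "x \<in> S" "y \<in> S" for x y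
    using that h h' by (simp add: bij_betw_apply)
  ultimately show ?thesis
    unfolding isomorphic_def by blast
qed

lemma dual_dual [simp]: "dual (dual f) = f"
  by (simp add: dual_def)

lemma isomorphic_dual: "isomorphic S (dual f) T (dual g) \<longleftrightarrow> isomorphic S f T g"
  unfolding isomorphic_def dual_def by blast

lemma isomorphic_dual_left: "isomorphic S (dual f) T g \<longleftrightarrow> isomorphic S f T (dual g)"
  using isomorphic_dual[of S f T "dual g"] by simp

lemma equiv_iso_rel: "equiv {f. semigroup_on {..<n} f} (iso_rel n)"
  unfolding iso_rel_def
  by (rule equivI) (auto simp: refl_on_def sym_def trans_def
      intro: isomorphic_refl isomorphic_sym isomorphic_trans)

lemma equiv_iso_anti_rel: "equiv {f. semigroup_on {..<n} f} (iso_anti_rel n)"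
proof (rule equivI)
  show "iso_anti_rel n \<subseteq> {f. semigroup_on {..<n} f} \<times> {f. semigroup_on {..<n} f}"
    by (auto simp: iso_anti_rel_def)
  show "refl_on {f. semigroup_on {..<n} f} (iso_anti_rel n)"
    by (auto simp: refl_on_def iso_anti_rel_def isomorphic_refl)
  show "sym (iso_anti_rel n)"
    unfolding sym_def iso_anti_rel_def anti_isomorphic_def
    using isomorphic_sym isomorphic_dual_left by blast
  show "trans (iso_anti_rel n)"
    unfolding trans_def iso_anti_rel_def anti_isomorphic_def
    using isomorphic_trans isomorphic_dual_left isomorphic_dual by (smt (verit) case_prodD case_prodI mem_Collect_eq dual_dual)
qed

lemma semigroup_transport:
  assumes S: "semigroup_on S f" and fin: "finite S" and n: "card S = n"
  shows "\<exists>g. semigroup_on {..<n} g \<and> isomorphic S f {..<n} g"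
proof -
  obtain h where h: "bij_betw h S {..<n}"
    using ex_bij_betw_finite_nat[OF fin] n by (auto simp: atLeast0LessThan)
  let ?k = "inv_into S h"
  let ?g = "\<lambda>u v. h (f (?k u) (?k v))"
  have k: "?k u \<in> S" if "u < n" for u
    using bij_betwE[OF bij_betw_inv_into[OF h]] that by simp
  have kh: "?k (h x) = x" if "x \<in> S" for x
    using h that by (rule bij_betw_inv_into_left)
  have cl: "f x y \<in> S" if "x \<in> S" "y \<in> S" for x y
    using S that unfolding semigroup_on_def by blast
  have as: "f (f x y) z = f x (f y z)" if "x \<in> S" "y \<in> S" "z \<in> S" for x y z
    using S that unfolding semigroup_on_def by blast
  have hS: "h x < n" if "x \<in> S" for x
    using bij_betwE[OF h] that by simp
  have "semigroup_on {..<n} ?g"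
    unfolding semigroup_on_def using hS cl k kh as by simp
  moreover have "isomorphic S f {..<n} ?g"
    unfolding isomorphic_def using h kh by (intro exI[of _ h]) simp
  ultimately show ?thesis by blast
qed

end

theory Submission
  imports Defs
begin

text \<open>
  In a semigroup \<open>S\<close> of order \<open>n\<close> and coclass \<open>1\<close> the series \<open>S \<supset> S\<^sup>2 \<supset> S\<^sup>3 \<supset> \<dots>\<close> loses two elements
  in the first step, because a single generator would force coclass \<open>0\<close>, and one element in
  every later step. So \<open>S\<close> has two generators. As \<open>n \<ge> 5\<close>, one of them, say \<open>a\<close>, has
  \<open>a\<^sup>2 \<notin> S\<^sup>3\<close>; its powers then run through all of \<open>S\<^sup>2\<close>, ending in the zero \<open>a\<^sup>n\<^sup>-\<^sup>1\<close>. The products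
  \<open>b a\<close>, \<open>a b\<close> and \<open>b b\<close> with the other generator \<open>b\<close> are powers of \<open>a\<close>, and their exponents
  \<open>p + 1\<close>, \<open>q + 1\<close>, \<open>m\<close> determine \<open>S\<close>. Associativity restricts these exponents, an isomorphism
  can exchange \<open>a\<close> and \<open>b\<close> only when all products of generators coincide, and passing to the
  dual exchanges \<open>p\<close> and \<open>q\<close>. Hence all three counts reduce to counting exponent triples.
\<close>

section \<open>Counting classes by representatives\<close>

text \<open>\<open>C\<close> may be larger than \<open>A\<close>, so the relations on all semigroups
  serve unchanged for counting the commutative ones.\<close>

lemma card_quotient_representatives:
  assumes R: "equiv C R" and A: "A \<subseteq> C" and rep: "rep ` P \<subseteq> A"
    and inj: "\<And>t t'. t \<in> P \<Longrightarrow> t' \<in> P \<Longrightarrow> (rep t, rep t') \<in> R \<Longrightarrow> t = t'"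
    and cover: "\<And>x. x \<in> A \<Longrightarrow> \<exists>t\<in>P. (x, rep t) \<in> R"
  shows "card (A // R) = card P"
proof -
  have "bij_betw (\<lambda>t. R `` {rep t}) P (A // R)"
    unfolding bij_betw_def
  proof
    show "inj_on (\<lambda>t. R `` {rep t}) P"
    proof (rule inj_onI)
      fix t t' assume t: "t \<in> P" "t' \<in> P" and eq: "R `` {rep t} = R `` {rep t'}"
      have "rep t' \<in> C" using t(2) rep A by blast
      then have "(rep t, rep t') \<in> R" using eq_equiv_class[OF eq R] by simp
      then show "t = t'" using inj t by blast
    qed
    show "(\<lambda>t. R `` {rep t}) ` P = A // R"
    proof
      show "(\<lambda>t. R `` {rep t}) ` P \<subseteq> A // R"
        using rep by (auto simp: quotient_def)
      show "A // R \<subseteq> (\<lambda>t. R `` {rep t}) ` P"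
      proof
        fix X assume "X \<in> A // R"
        then obtain x where x: "x \<in> A" "X = R `` {x}" by (auto elim: quotientE)
        then obtain t where t: "t \<in> P" "(x, rep t) \<in> R" using cover by blast
        with x R show "X \<in> (\<lambda>t. R `` {rep t}) ` P"
          using equiv_class_eq[OF R t(2)] by blast
      qed
    qed
  qed
  then show ?thesis by (simp add: bij_betw_same_card)
qed

section \<open>Products of \<open>k\<close> factors and powers\<close>

lemma products_Suc_0: "products S f (Suc 0) = S"
  unfolding products_def by auto

lemma products_Suc:
  assumes "k > 0"
  shows "products S f (Suc k) = {f x s | x s. x \<in> products S f k \<and> s \<in> S}" (is "?L = ?R")
proof
  show "?L \<subseteq> ?R"
  proof
    fix u assume "u \<in> ?L"
    then obtain x xs where u: "u = foldl f x xs" "x \<in> S" "set xs \<subseteq> S" "length xs = k"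
      unfolding products_def by auto
    then obtain ys y where xs: "xs = ys @ [y]"
      using assms by (metis length_0_conv less_numeral_extra(3) rev_exhaust)
    have "foldl f x ys \<in> products S f k"
      unfolding products_def using u xs by auto
    then show "u \<in> ?R" using u xs by auto
  qed
  show "?R \<subseteq> ?L"
  proof
    fix u assume "u \<in> ?R"
    then obtain x xs s where u: "u = f (foldl f x xs) s" "x \<in> S" "set xs \<subseteq> S"
      "Suc (length xs) = k" "s \<in> S"
      unfolding products_def by auto
    then have "u = foldl f x (xs @ [s])" "set (xs @ [s]) \<subseteq> S" "Suc (length (xs @ [s])) = Suc k"
      by auto
    with u(2) show "u \<in> ?L" unfolding products_def by blast
  qed
qed

text \<open>The value \<open>power_on f a i\<close> is the power of \<open>a\<close> with exponent \<open>i + 1\<close>.\<close>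

primrec power_on :: "('a \<Rightarrow> 'a \<Rightarrow> 'a) \<Rightarrow> 'a \<Rightarrow> nat \<Rightarrow> 'a" where
  "power_on f a 0 = a"
| "power_on f a (Suc i) = f (power_on f a i) a"

subsection \<open>Normal forms\<close>

text \<open>
  The number \<open>i \<ge> 1\<close> stands for \<open>a\<^sup>i\<close>, with zero \<open>n - 1\<close>, and \<open>0\<close> stands for the generator \<open>b\<close>,
  which multiplies powers of \<open>a\<close> like \<open>a\<^sup>p\<close> from the left and like \<open>a\<^sup>q\<close> from the right.
\<close>

definition model :: "nat \<Rightarrow> nat \<Rightarrow> nat \<Rightarrow> nat \<Rightarrow> nat \<Rightarrow> nat \<Rightarrow> nat" where
  "model n p q m x y =
     (if x = 0 \<and> y = 0 then m
      else min (n - 1) ((if x = 0 then p else x) + (if y = 0 then q else y)))"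

text \<open>
  The two equations compare the exponents in \<open>a (b a) = (a b) a\<close> and \<open>(b b) a = b (b a)\<close>, truncated
  because all exponents from \<open>n - 1\<close> on give zero.
\<close>

definition params :: "nat \<Rightarrow> (nat \<times> nat \<times> nat) set" where
  "params n = {(p, q, m). 1 \<le> p \<and> p \<le> n - 2 \<and> 1 \<le> q \<and> q \<le> n - 2 \<and> m \<le> n - 1 \<and>
     min p (n - 3) = min q (n - 3) \<and> min m (n - 2) = min (2 * p) (n - 2)}"

lemma min_eq_min_iff: "min x a = min y a \<longleftrightarrow> x = y \<or> a \<le> x \<and> a \<le> (y :: 'a :: linorder)"
  by (auto simp: min_def)

lemma paramsD:
  assumes "n \<ge> 5" "(p, q, m) \<in> params n"
  shows "1 \<le> p" "p \<le> n - 2" "1 \<le> q" "q \<le> n - 2" "2 \<le> m" "m \<le> n - 1"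
    "min p (n - 3) = min q (n - 3)" "min m (n - 2) = min (2 * p) (n - 2)"
proof -
  show "1 \<le> p" "p \<le> n - 2" "1 \<le> q" "q \<le> n - 2" "m \<le> n - 1"
    "min p (n - 3) = min q (n - 3)" "min m (n - 2) = min (2 * p) (n - 2)"
    using assms by (auto simp: params_def)
  then show "2 \<le> m" using assms(1) by linarith
qed

text \<open>This reflects the passage to the dual. Only the condition on \<open>m\<close> is
  asymmetric in \<open>p\<close> and \<open>q\<close>; if these differ, both are at least
  \<open>n - 3\<close>, and doubling either one reaches the truncation bound
  \<open>n - 2\<close>.\<close>

lemma params_swap:
  assumes "n \<ge> 5" "(p, q, m) \<in> params n"
  shows "(q, p, m) \<in> params n"
proof -
  note t = paramsD[OF assms]
  have "min (2 * p) (n - 2) = min (2 * q) (n - 2)"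
  proof (cases "p = q")
    case False
    then have "n - 3 \<le> p" "n - 3 \<le> q" using t(7) unfolding min_eq_min_iff by simp_all
    then have "n - 2 \<le> 2 * p" "n - 2 \<le> 2 * q" using assms(1) by linarith+
    then show ?thesis unfolding min_eq_min_iff by simp
  qed simp
  then show ?thesis using t by (simp add: params_def)
qed

lemma model_less: "m < n \<Longrightarrow> model n p q m x y < n"
  by (auto simp: model_def min_less_iff_disj)

lemma model_generators:
  assumes "p \<le> n - 2" "q \<le> n - 2" "n \<ge> 2"
  shows "model n p q m 0 0 = m" "model n p q m 0 (Suc 0) = Suc p" "model n p q m (Suc 0) 0 = Suc q"
    "model n p q m (Suc 0) (Suc 0) = min (n - 1) 2"
  using assms by (auto simp: model_def)

text \<open>Two instances of associativity already force the conditions of \<open>params\<close>.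
  Conversely, where these conditions let \<open>p\<close> and \<open>q\<close>, or \<open>m\<close>
  and \<open>2 * p\<close>, differ, both sides of the affected associative laws are truncated to the
  zero \<open>n - 1\<close>.\<close>

lemma semigroup_model_iff:
  assumes n: "n \<ge> 5" and "1 \<le> p" "p \<le> n - 2" "1 \<le> q" "q \<le> n - 2" "2 \<le> m" "m \<le> n - 1"
  shows "semigroup_on {..<n} (model n p q m) \<longleftrightarrow> (p, q, m) \<in> params n"
proof
  let ?g = "model n p q m"
  assume "semigroup_on {..<n} ?g"
  then have assoc: "?g (?g 1 0) 1 = ?g 1 (?g 0 1)" "?g (?g 0 0) 1 = ?g 0 (?g 0 1)"
    using n by (auto simp: semigroup_on_def)
  have "?g 1 0 = Suc q" "?g 0 1 = Suc p" "?g 0 0 = m" using assms by (auto simp: model_def)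
  with assoc have "?g (Suc q) 1 = ?g 1 (Suc p)" "?g m 1 = ?g 0 (Suc p)" by simp_all
  then have "min (n - 1) (Suc q + 1) = min (n - 1) (1 + Suc p)"
    "min (n - 1) (m + 1) = min (n - 1) (p + Suc p)"
    using assms by (simp_all add: model_def)
  \<comment> \<open>Successors can then be cancelled inside \<open>min\<close>, which lowers the
    bound \<open>n - 1\<close> to \<open>n - 3\<close> and \<open>n - 2\<close>.\<close>
  moreover have "n - 1 = Suc (Suc (n - 3))" "n - 1 = Suc (n - 2)" using n by simp_all
  ultimately have "min (Suc (Suc (n - 3))) (Suc (Suc q)) = min (Suc (Suc (n - 3))) (Suc (Suc p))"
    "min (Suc (n - 2)) (Suc m) = min (Suc (n - 2)) (Suc (2 * p))" by (simp_all only: mult_2 add_Suc_right Suc_eq_plus1[symmetric] plus_1_eq_Suc)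
  then have "min p (n - 3) = min q (n - 3)" "min m (n - 2) = min (2 * p) (n - 2)"
    by (simp_all only: min_Suc_Suc nat.inject min.commute)
  then show "(p, q, m) \<in> params n"
    using assms unfolding params_def by simp
next
  let ?g = "model n p q m"
  assume "(p, q, m) \<in> params n"
  then have *: "min p (n - 3) = min q (n - 3)" "min m (n - 2) = min (2 * p) (n - 2)"
    by (auto simp: params_def)
  have "?g (?g x y) z = ?g x (?g y z)" if "x < n" "y < n" "z < n" for x y z
  proof -
    \<comment> \<open>No product is the generator \<open>b\<close>, so the outer multiplications
      always add exponents.\<close>
    have pos: "(?g u v = 0) = False" for u v
      using assms(2-7) n by (auto simp: model_def)
    have cap: "min N (min N u + v) = min N (u + v)" "min N (u + min N v) = min N (u + v)"
      for N u v :: nat by linarith+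
    have capI: "u = v \<or> N \<le> u \<and> N \<le> v \<Longrightarrow> min N u = min N v" for N u v :: nat
      by auto
    have pq: "p = q \<or> n - 1 \<le> p + 2 \<and> n - 1 \<le> q + 2"
      using *(1) unfolding min_eq_min_iff by auto
    have m: "m = 2 * p \<or> n - 1 \<le> m + 1 \<and> n - 1 \<le> 2 * p + 1"
      using *(2) unfolding min_eq_min_iff by auto
    have n1: "2 * (n - 1) \<ge> n - 1 + 4" using n by simp
    \<comment> \<open>One case for each choice of the factors that are \<open>b\<close>: both sides
      become truncated sums, which by \<open>capI\<close> either agree or both reach
      \<open>n - 1\<close>.\<close>
    show ?thesis
      unfolding model_def[of n p q m "?g x y"] model_def[of n p q m x "?g y z"]
      unfolding pos if_False simp_thms
      unfolding model_def
      by (cases "x = 0"; cases "y = 0"; cases "z = 0"; simp only: if_True if_False simp_thms cap;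
          rule capI; use pq m n1 assms(2,4,6) in arith)
  qed
  moreover have "?g x y < n" for x y using assms by (auto simp: model_def)
  ultimately show "semigroup_on {..<n} ?g" by (simp add: semigroup_on_def)
qed

subsection \<open>The series of powers of a semigroup\<close>

locale semigroup_carrier =
  fixes S :: "'a set" and f :: "'a \<Rightarrow> 'a \<Rightarrow> 'a"
  assumes semigroup: "semigroup_on S f"
begin

lemma closed: "x \<in> S \<Longrightarrow> y \<in> S \<Longrightarrow> f x y \<in> S"
  using semigroup by (simp add: semigroup_on_def)

lemma assoc: "x \<in> S \<Longrightarrow> y \<in> S \<Longrightarrow> z \<in> S \<Longrightarrow> f (f x y) z = f x (f y z)"
  using semigroup by (simp add: semigroup_on_def)

abbreviation P :: "nat \<Rightarrow> 'a set" where
  "P \<equiv> products S f"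

lemma products_Suc_subset: "k > 0 \<Longrightarrow> P (Suc k) \<subseteq> P k"
proof (induction k rule: nat_induct_non_zero)
  case 1
  then show ?case by (auto simp: products_Suc products_Suc_0 closed)
next
  case (Suc k)
  then show ?case by (subst (1 2) products_Suc) auto
qed

lemma products_antimono:
  assumes "0 < i" "i \<le> j"
  shows "P j \<subseteq> P i"
  using assms(2)
proof (induction j rule: dec_induct)
  case (step j)
  then show ?case using products_Suc_subset[of j] assms(1) by simp
qed simp

lemma products_subset: "k > 0 \<Longrightarrow> P k \<subseteq> S"
  using products_antimono[of 1 k] by (simp add: products_Suc_0)

lemma products_mult:
  assumes "i > 0" "j > 0" "x \<in> P i" "y \<in> P j"
  shows "f x y \<in> P (i + j)"
  using assms(2,4)
proof (induction j arbitrary: y rule: nat_induct_non_zero)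
  case 1
  then show ?case using assms by (auto simp: products_Suc products_Suc_0)
next
  case (Suc j)
  then obtain u s where us: "y = f u s" "u \<in> P j" "s \<in> S"
    by (auto simp: products_Suc)
  moreover have "x \<in> S" "u \<in> S" using us assms Suc.hyps products_subset by blast+
  ultimately have "f x y = f (f x u) s" by (simp add: assoc)
  moreover have "f x u \<in> P (i + j)" using us Suc.IH by blast
  ultimately show ?case using us assms(1) by (auto simp: products_Suc)
qed

lemma power_on_products: "a \<in> S \<Longrightarrow> power_on f a i \<in> P (Suc i)"
  by (induction i) (auto simp: products_Suc_0 products_Suc)

lemma power_on_closed: "a \<in> S \<Longrightarrow> power_on f a i \<in> S"
  by (induction i) (auto simp: closed)

lemma power_on_add:
  assumes "a \<in> S"
  shows "f (power_on f a i) (power_on f a j) = power_on f a (Suc (i + j))"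
proof (induction j)
  case (Suc j)
  have "f (power_on f a i) (f (power_on f a j) a) = f (f (power_on f a i) (power_on f a j)) a"
    using assms by (simp add: assoc power_on_closed)
  then show ?case using Suc by simp
qed simp

text \<open>Each term arises from its predecessor by multiplication with \<open>S\<close>, so one
  repetition freezes the series.\<close>

lemma products_stationary:
  assumes "0 < k" "P (Suc k) = P k" "k \<le> j"
  shows "P j = P k"
  using assms(3)
proof (induction j rule: dec_induct)
  case (step j)
  then have "P (Suc j) = {f x s | x s. x \<in> P k \<and> s \<in> S}"
    using assms(1) by (simp add: products_Suc)
  also have "\<dots> = P (Suc k)" using assms(1) by (simp add: products_Suc)
  finally show ?case using assms(2) by simp
qed simp

end

subsection \<open>Classification\<close>

locale coclass_one_semigroup = semigroup_carrier S f
  for S :: "'a set" and f +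
  fixes n :: nat
  assumes card_S: "card S = n" and n: "n \<ge> 5"
    and nilp: "nilpotent_on S f" and coclass_1: "coclass S f = 1"
begin

lemma finite_S: "finite S"
  using card_S n by (metis card.infinite not_numeral_le_zero)

lemma finite_P: "k > 0 \<Longrightarrow> finite (P k)"
  using finite_subset[OF products_subset finite_S] .

lemma class_eq: "nilpotency_class S f = n - 2"
  using coclass_1 card_S n by (simp add: coclass_def)

lemma card_P_last: "card (P (n - 1)) = 1"
proof -
  obtain c where "card (P (c + 1)) = 1" using nilp by (auto simp: nilpotent_on_def)
  then have "card (P ((LEAST c. card (P (c + 1)) = 1) + 1)) = 1" by (rule LeastI)
  then have "card (P (n - 2 + 1)) = 1" using class_eq by (simp add: nilpotency_class_def)
  moreover have "n - 2 + 1 = n - 1" using n by simp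
  ultimately show ?thesis by simp
qed

text \<open>A repetition at \<open>k\<close> would freeze the series at the singleton
  \<open>P (n - 1)\<close>, and the class would be at most \<open>k - 1\<close>.\<close>

lemma P_psubset:
  assumes "0 < k" "k < n - 1"
  shows "P (Suc k) \<subset> P k"
proof -
  have "P (Suc k) \<noteq> P k"
  proof
    assume "P (Suc k) = P k"
    then have "card (P (k - 1 + 1)) = 1"
      using products_stationary[of k "n - 1"] assms card_P_last by simp
    then have "nilpotency_class S f \<le> k - 1"
      unfolding nilpotency_class_def by (rule Least_le)
    then show False using class_eq assms by simp
  qed
  then show ?thesis using products_Suc_subset[of k] assms(1) by blast
qed

lemma card_P_Suc: "0 < k \<Longrightarrow> k < n - 1 \<Longrightarrow> card (P (Suc k)) < card (P k)"
  using P_psubset finite_P psubset_card_mono by metis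

lemma card_P_upper_step: "0 < j \<Longrightarrow> j \<le> k \<Longrightarrow> k \<le> n - 1 \<Longrightarrow> card (P k) + (k - j) \<le> card (P j)"
proof (rotate_tac, induction k rule: dec_induct)
  case (step k)
  have "card (P (Suc k)) < card (P k)" using card_P_Suc step by simp
  then show ?case using step by simp
qed simp

text \<open>Strict descent leaves only \<open>n - 2\<close> and \<open>n - 1\<close>. In the latter
  case there is a single generator \<open>a\<close>, so each step loses at most one element, namely
  a power of \<open>a\<close>; the \<open>n - 2\<close> steps from \<open>S\<close> to
  \<open>P (n - 1)\<close> then cannot reduce \<open>n\<close> elements to one.\<close>

lemma card_P_2: "card (P 2) = n - 2"
proof (rule ccontr)
  assume neq: "card (P 2) \<noteq> n - 2"
  have "card (P (n - 1)) + (n - 1 - 2) \<le> card (P 2)"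
    using n by (intro card_P_upper_step) auto
  then have "n - 2 \<le> card (P 2)" using card_P_last n by simp
  moreover have "card (P 2) < card S"
    using card_P_Suc[of 1] n by (simp add: products_Suc_0 numeral_2_eq_2)
  ultimately have c2: "card (P 2) = n - 1" using neq card_S by simp
  have sub: "P 2 \<subseteq> S" using products_subset by simp
  have "card (S - P 2) = 1"
    using card_Diff_subset[of "P 2" S] finite_P[of 2] sub c2 card_S n by simp
  then obtain a where a: "S - P 2 = {a}" by (auto simp: card_1_singleton_iff)
  have aS: "a \<in> S" using a by blast
  \<comment> \<open>A product drops to the next term unless its left factor is a power of
    \<open>a\<close> and its right factor is \<open>a\<close> itself.\<close>
  have layer: "P (Suc k) \<subseteq> insert (power_on f a k) (P (Suc (Suc k)))" for k
  proof (induction k)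
    case 0
    then show ?case using a by (auto simp: products_Suc_0 numeral_2_eq_2)
  next
    case (Suc k)
    show ?case
    proof
      fix u assume "u \<in> P (Suc (Suc k))"
      then obtain x s where u: "u = f x s" "x \<in> P (Suc k)" "s \<in> S"
        by (auto simp: products_Suc[of "Suc k"])
      consider "x \<in> P (Suc (Suc k))" | "s \<in> P 2" | "x = power_on f a k" "s = a"
        using Suc u a by blast
      then show "u \<in> insert (power_on f a (Suc k)) (P (Suc (Suc (Suc k))))"
      proof cases
        case 1
        then show ?thesis using u by (auto simp: products_Suc[of "Suc (Suc k)"])
      next
        case 2
        then show ?thesis using products_mult[of "Suc k" 2 x s] u by simp
      qed (use u in simp)
    qed
  qed
  have step: "card (P (Suc k)) \<le> Suc (card (P (Suc (Suc k))))" for k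
  proof -
    have "card (P (Suc k)) \<le> card (insert (power_on f a k) (P (Suc (Suc k))))"
      using layer finite_P by (intro card_mono) auto
    also have "\<dots> \<le> Suc (card (P (Suc (Suc k))))" by (simp add: card_insert_le_m1 card_insert_if finite_P)
    finally show ?thesis .
  qed
  have "card (P (Suc 0)) \<le> k + card (P (Suc k))" for k
  proof (induction k)
    case (Suc k)
    then show ?case using step[of k] by linarith
  qed simp
  from this[of "n - 2"] have "n \<le> n - 2 + card (P (Suc (n - 2)))"
    by (simp add: products_Suc_0 card_S)
  moreover have "Suc (n - 2) = n - 1" using n by simp
  ultimately show False using card_P_last n by simp
qed

text \<open>The \<open>n - 3\<close> strict steps from \<open>P 2\<close> to
  \<open>P (n - 1)\<close> lose \<open>n - 3\<close> elements altogether, hence exactly one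
  each.\<close>

lemma card_P: "2 \<le> k \<Longrightarrow> k \<le> n - 1 \<Longrightarrow> card (P k) = n - k"
  using card_P_upper_step[of 2 k] card_P_upper_step[of k "n - 1"] card_P_2 card_P_last by simp

lemma layer_nonempty: "0 < k \<Longrightarrow> k < n - 1 \<Longrightarrow> \<exists>u. u \<in> P k \<and> u \<notin> P (Suc k)"
  using P_psubset by blast

text \<open>This is how elements get identified below. The bound \<open>2 \<le> k\<close> excludes
  the first layer, which consists of two generators.\<close>

lemma layer_unique:
  assumes "2 \<le> k" "k < n - 1" "u \<in> P k" "u \<notin> P (Suc k)" "v \<in> P k" "v \<notin> P (Suc k)"
  shows "u = v"
proof -
  have "P (Suc k) \<subseteq> P k" using products_Suc_subset assms(1) by simp
  then have "card (P k - P (Suc k)) = card (P k) - card (P (Suc k))"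
    using finite_P by (intro card_Diff_subset) auto
  also have "\<dots> = 1" using card_P[of k] card_P[of "Suc k"] assms(1,2) by simp
  finally obtain w where "P k - P (Suc k) = {w}" by (auto simp: card_1_singleton_iff)
  then show ?thesis using assms by (metis Diff_iff singletonD)
qed

lemma generators: "\<exists>a b. a \<noteq> b \<and> S - P 2 = {a, b}"
proof -
  have "P 2 \<subseteq> S" using products_subset by simp
  then have "card (S - P 2) = 2"
    using card_Diff_subset[of "P 2" S] finite_P[of 2] card_P_2 card_S n by simp
  then show ?thesis by (auto simp: card_2_iff)
qed

text \<open>
  A product \<open>x y z\<close> outside \<open>S\<^sup>4\<close> has all factors among the two generators, so two of the factors
  coincide, while \<open>x y\<close> and \<open>y z\<close> both equal the only element of \<open>S\<^sup>2\<close> outside \<open>S\<^sup>3\<close>.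
\<close>

lemma square_top_layer: "\<exists>a. a \<in> S - P 2 \<and> f a a \<notin> P 3"
proof -
  have two: "s \<in> P 2" if "s = f x y" "x \<in> S" "y \<in> S" for s x y
    using that by (auto simp: numeral_2_eq_2 products_Suc products_Suc_0)
  have eq: "f x y = f u v" if "x \<in> S" "y \<in> S" "u \<in> S" "v \<in> S" "f x y \<notin> P 3" "f u v \<notin> P 3" for x y u v
    using layer_unique[of 2 "f x y" "f u v"] that two n by (simp add: numeral_3_eq_3 numeral_2_eq_2)
  have m3: "f x s \<in> P 4" "f s x \<in> P 4" if "x \<in> P 3" "s \<in> S" for x s
    using products_mult[of 3 1 x s] products_mult[of 1 3 s x] that
    by (simp_all add: products_Suc_0)
  \<comment> \<open>Here \<open>n \<ge> 5\<close> enters: the descent must not have ended at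
    \<open>P 3\<close>.\<close>
  obtain w where w: "w \<in> P 3" "w \<notin> P 4"
  proof -
    have "3 < n - 1" using n by linarith
    then show ?thesis using that layer_nonempty[of 3] by auto
  qed
  obtain v z where v: "w = f v z" "v \<in> P 2" "z \<in> S"
    using w(1) products_Suc[of 2 S f] by auto
  obtain x y where xy: "v = f x y" "x \<in> S" "y \<in> S"
    using v(2) by (auto simp: numeral_2_eq_2 products_Suc products_Suc_0)
  note S = xy(2,3) v(3)
  have nz: "z \<notin> P 2" using products_mult[of 2 2 v z] v w by auto
  have w': "w = f x (f y z)" using v xy assoc by simp
  have nxy: "f x y \<notin> P 3" using m3 v xy w by blast
  have nyz: "f y z \<notin> P 3" using m3 w' S w by metis
  have nx: "x \<notin> P 2" using products_mult[of 2 1 x y] nxy S by (auto simp: products_Suc_0 eval_nat_numeral)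
  have ny: "y \<notin> P 2" using products_mult[of 1 2 x y] nxy S by (auto simp: products_Suc_0 eval_nat_numeral)
  obtain a b where "S - P 2 = {a, b}" using generators by blast
  then have "x \<in> {a, b}" "y \<in> {a, b}" "z \<in> {a, b}" using nx ny nz S by auto
  then consider "x = y" | "y = z" | "x = z" by auto
  then show ?thesis
  proof cases
    case 3
    \<comment> \<open>In \<open>x y x\<close> the factors commute, which brings the two equal ones
      together.\<close>
    have "f x y = f y x" using eq S nxy nyz 3 by blast
    then have "w = f (f x x) y" using w' 3 S assoc by simp
    then have "f x x \<notin> P 3" using m3 S w by blast
    then show ?thesis using nx S by blast
  qed (use nxy nyz nx ny S in blast)+
qed


text \<open>The powers of \<open>a\<close> occupy one layer each, so together with \<open>b\<close>
  they exhaust \<open>S\<close>, and the exponents of \<open>f b a\<close>, \<open>f a b\<close> and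
  \<open>f b b\<close> yield the model. The conditions on them come from associativity, pulled back
  along the bijection \<open>h\<close>.\<close>

lemma classification:
  "\<exists>p q m. (p, q, m) \<in> params n \<and> isomorphic {..<n} (model n p q m) S f"
proof -
  obtain a where a: "a \<in> S" "a \<notin> P 2" "f a a \<notin> P 3" using square_top_layer by blast
  obtain b where b: "b \<noteq> a" "S - P 2 = {a, b}"
    using generators a by (metis DiffI doubleton_eq_iff insertE singletonD)
  have bS: "b \<in> S" "b \<notin> P 2" using b by auto
  define w where "w = power_on f a"
  have w0: "w 0 = a" and wS: "w (Suc i) = f (w i) a" for i by (simp_all add: w_def)
  have wP: "w i \<in> P (Suc i)" for i unfolding w_def by (rule power_on_products[OF a(1)])
  have wS': "w i \<in> S" for i unfolding w_def by (rule power_on_closed[OF a(1)])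
  have wadd: "f (w i) (w j) = w (Suc (i + j))" for i j
    unfolding w_def by (rule power_on_add[OF a(1)])
  have two: "f x y \<in> P 2" if "x \<in> S" "y \<in> S" for x y
    using products_mult[of 1 1 x y] that by (simp add: products_Suc_0 numeral_2_eq_2)
  \<comment> \<open>Take \<open>u = f v s\<close> in the next layer. Uniqueness gives
    \<open>v = w (Suc i)\<close>; after regrouping, \<open>f a s\<close> must lie outside
    \<open>P 3\<close>, hence equals \<open>f a a\<close>, and \<open>u\<close> is the next
    power.\<close>
  have w_notin: "w (Suc i) \<notin> P (Suc (Suc (Suc i)))" if "i < n - 3" for i
    using that
  proof (induction i)
    case 0
    then show ?case using a(3) by (simp add: wS w0 numeral_3_eq_3)
  next
    case (Suc i)
    then have IH: "w (Suc i) \<notin> P (Suc (Suc (Suc i)))" by simp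
    obtain u where u: "u \<in> P (Suc (Suc (Suc i)))" "u \<notin> P (Suc (Suc (Suc (Suc i))))"
    proof -
      have "Suc (Suc (Suc i)) < n - 1" using Suc.prems by linarith
      then show ?thesis using that layer_nonempty[of "Suc (Suc (Suc i))"] by auto
    qed
    then obtain v s where v: "u = f v s" "v \<in> P (Suc (Suc i))" "s \<in> S"
      using products_Suc[of "Suc (Suc i)" S f] by auto
    have "v \<notin> P (Suc (Suc (Suc i)))"
      using products_Suc[of "Suc (Suc (Suc i))" S f] v u by auto
    then have vw: "v = w (Suc i)"
      using layer_unique[of "Suc (Suc i)" v "w (Suc i)"] v IH wP Suc.prems by simp
    have u': "u = f (w i) (f a s)"
      using v vw wS assoc[OF wS' a(1) v(3)] by simp
    have "f a s \<notin> P 3"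
      using products_mult[of "Suc i" 3 "w i" "f a s"] wP u u' by (auto simp: eval_nat_numeral)
    then have "f a s = f a a"
      using layer_unique[of 2 "f a s" "f a a"] a two v n by (simp add: eval_nat_numeral)
    then have "u = w (Suc (Suc i))"
      using u' wS assoc[OF wS' a(1) a(1)] by simp
    then show ?case using u by simp
  qed
  have w_notin: "w i \<notin> P (Suc (Suc i))" if "i < n - 2" for i
    using w_notin[of "i - 1"] that a(2) by (cases i) (auto simp: w0 numeral_2_eq_2)
  obtain z where z: "P (n - 1) = {z}" using card_P_last by (auto simp: card_1_singleton_iff)
  have w_zero: "w i = z" if "n - 2 \<le> i" for i
  proof -
    have "w i \<in> P (n - 1)" using wP products_antimono[of "n - 1" "Suc i"] that n by (auto simp: le_diff_conv)
    then show ?thesis using z by simp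
  qed
  have w_min: "w i = w (min i (n - 2))" for i
    using w_zero by (cases "i \<le> n - 2") (simp_all add: min_def)
  have w_inj: "w i \<noteq> w j" if "i < j" "j \<le> n - 2" for i j
  proof -
    have "w j \<in> P (Suc (Suc i))" using wP products_antimono[of "Suc (Suc i)" "Suc j"] that by auto
    moreover have "w i \<notin> P (Suc (Suc i))" using w_notin that by simp
    ultimately show ?thesis by metis
  qed
  have w_b: "w i \<noteq> b" for i
    using b(1) bS(2) wP[of i] products_antimono[of 2 "Suc i"] by (cases i) (auto simp: w0)
  define h where "h = (\<lambda>x. case x of 0 \<Rightarrow> b | Suc i \<Rightarrow> w i)"
  have h0: "h 0 = b" and hS: "h (Suc i) = w i" for i by (simp_all add: h_def)
  have "inj_on h {..<n}"
  proof (rule linorder_inj_onI)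
    fix x y assume xy: "x < y" "x \<in> {..<n}" "y \<in> {..<n}"
    then show "h x \<noteq> h y"
      using w_inj[of "x - 1" "y - 1"] w_b[of "y - 1"] by (cases x; cases y) (auto simp: h0 hS)
  qed auto
  moreover have "h x \<in> S" for x by (cases x) (auto simp: h0 hS bS wS')
  then have "h ` {..<n} \<subseteq> S" by blast
  ultimately have "h ` {..<n} = S"
    using finite_S card_S by (intro card_subset_eq) (auto simp: card_image)
  with \<open>inj_on h {..<n}\<close> have h: "bij_betw h {..<n} S" by (simp add: bij_betw_def)
  \<comment> \<open>All elements are values of \<open>h\<close>, and those at \<open>0\<close> and
    \<open>1\<close> are the generators \<open>b\<close> and \<open>a\<close>, which lie outside
    \<open>P 2\<close>.\<close>
  have square: "\<exists>k. Suc k < n \<and> 0 < k \<and> u = w k" if "u \<in> P 2" for u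
  proof -
    have "u \<in> h ` {..<n}" using that \<open>h ` {..<n} = S\<close> products_subset[of 2] by auto
    then obtain x where x: "x < n" "u = h x" by blast
    then obtain i where "x = Suc i" using \<open>u \<in> P 2\<close> bS(2) by (metis h0 not0_implies_Suc)
    moreover have "i \<noteq> 0" using that x calculation a by (metis hS w0)
    ultimately show ?thesis using x by (auto simp: hS)
  qed
  obtain q where q: "Suc q < n" "0 < q" "f a b = w q" using square two a bS by blast
  obtain p where p: "Suc p < n" "0 < p" "f b a = w p" using square two a bS by blast
  obtain m where m: "Suc m < n" "0 < m" "f b b = w m" using square two a bS by blast
  have wb: "f (w i) b = w (i + q)" for i
  proof (cases i)
    case (Suc j)
    then have "f (w i) b = f (w j) (f a b)" using assoc[OF wS' a(1) bS(1)] wS by simp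
    then show ?thesis using q wadd Suc by simp
  qed (use q w0 in simp)
  have bw: "f b (w i) = w (i + p)" for i
  proof (induction i)
    case (Suc i)
    then have "f b (w (Suc i)) = f (w (i + p)) a" using assoc[OF bS(1) wS' a(1), of i] wS by metis
    then show ?case using wS by simp
  qed (use p w0 in simp)
  \<comment> \<open>As \<open>w i\<close> has exponent \<open>i + 1\<close>, the product
    \<open>f b b = w m\<close> is encoded as \<open>Suc m\<close>, whereas
    \<open>f b a = w p\<close> means that \<open>b\<close> acts like the power with exponent
    \<open>p\<close>.\<close>
  let ?g = "model n p q (Suc m)"
  have hom: "h (?g x y) = f (h x) (h y)" for x y
  proof -
    have *: "h (min (n - 1) (Suc i)) = w i" for i
    proof -
      have "min (n - 1) (Suc i) = Suc (min i (n - 2))" using n by auto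
      then show ?thesis using w_min[of i] by (simp add: hS)
    qed
    show ?thesis
      by (cases x; cases y)
        (use *[of "_ + _"] *[of "Suc (_ + _)"] p q m in
          \<open>auto simp: model_def h0 hS wb bw wadd add.commute\<close>)
  qed
  have g_closed: "?g x y < n" for x y using m n by (auto simp: model_def)
  have "?g (?g x y) z = ?g x (?g y z)" if "x < n" "y < n" "z < n" for x y z
  proof -
    have "h (?g (?g x y) z) = h (?g x (?g y z))"
      using that \<open>\<And>x. h x \<in> S\<close> by (simp add: hom assoc)
    then show ?thesis using \<open>inj_on h {..<n}\<close> g_closed by (auto dest: inj_onD)
  qed
  then have "semigroup_on {..<n} ?g" using g_closed by (simp add: semigroup_on_def)
  then have "(p, q, Suc m) \<in> params n"
    using semigroup_model_iff[of n p q "Suc m"] p q m n by simp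
  moreover have "isomorphic {..<n} ?g S f" unfolding isomorphic_def using h hom by blast
  ultimately show ?thesis by blast
qed

end

subsection \<open>Isomorphisms between normal forms\<close>

lemma dual_model: "dual (model n p q m) = model n q p m"
  by (auto simp: dual_def model_def fun_eq_iff add.commute)

text \<open>Products of \<open>k\<close> factors have exponent at least
  \<open>min k (n - 1)\<close>. This value is attained by a power of \<open>1\<close>, and the zero
  \<open>n - 1\<close> is also such a product, so the series first becomes a singleton at
  \<open>n - 1\<close>.\<close>

lemma model_nilpotent:
  assumes n: "n \<ge> 5" and t: "(p, q, m) \<in> params n"
  shows "model n p q m \<in> nilpotent_semigroups n 1"
proof -
  let ?g = "model n p q m" and ?S = "{..<n}"
  note m = paramsD[OF n t]
  have sg: "semigroup_on ?S ?g"
    using semigroup_model_iff[of n p q m] t n m by blast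
  interpret semigroup_carrier ?S ?g by unfold_locales (rule sg)
  \<comment> \<open>The maximum gives the generator \<open>b\<close>, encoded as \<open>0\<close>,
    the weight 1.\<close>
  have bound: "min k (n - 1) \<le> max 1 x" if "x \<in> P k" "k > 0" for k x
    using that(2,1)
  proof (induction k arbitrary: x rule: nat_induct_non_zero)
    case (Suc k)
    then obtain u s where us: "x = ?g u s" "u \<in> P k" by (auto simp: products_Suc)
    then have "min k (n - 1) \<le> max 1 u" using Suc.IH by blast
    moreover have "min (n - 1) (Suc (max 1 u)) \<le> x"
    proof -
      have "min (n - 1) (Suc u) \<le> min (n - 1) (u + s)" if "s > 0" for s
        using that by linarith
      then show ?thesis
        unfolding us(1) using m by (cases "u = 0"; cases "s = 0") (auto simp: model_def max_def)
    qed
    ultimately show ?case by linarith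
  qed auto
  have powers: "min (Suc k) (n - 1) \<in> P (Suc k)" for k
  proof (induction k)
    case (Suc k)
    have "min (Suc (Suc k)) (n - 1) = ?g (min (Suc k) (n - 1)) 1"
      using n by (auto simp: model_def)
    moreover have "1 \<in> ?S" using n by simp
    ultimately show ?case using Suc products_Suc[of "Suc k" ?S ?g] by blast
  qed (use n in \<open>auto simp: products_Suc_0\<close>)
  have zero: "n - 1 \<in> P (Suc k)" for k
  proof (induction k)
    case (Suc k)
    have "n - 1 = ?g (n - 1) 1" using n by (auto simp: model_def)
    moreover have "1 \<in> ?S" using n by simp
    ultimately show ?case using Suc products_Suc[of "Suc k" ?S ?g] by blast
  qed (use n in \<open>auto simp: products_Suc_0\<close>)
  have "P (n - 1) = {n - 1}"
  proof
    show "P (n - 1) \<subseteq> {n - 1}"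
      using bound[of _ "n - 1"] products_subset[of "n - 1"] n by (fastforce simp: max_def split: if_splits)
    show "{n - 1} \<subseteq> P (n - 1)" using zero[of "n - 2"] n by (simp add: Suc_diff_Suc numeral_2_eq_2)
  qed
  then have last: "card (P (n - 2 + 1)) = 1" using n by (simp add: Suc_diff_Suc numeral_2_eq_2)
  have "card (P (c + 1)) \<noteq> 1" if "c < n - 2" for c
  proof
    assume "card (P (c + 1)) = 1"
    then obtain u where "P (Suc c) = {u}" by (auto simp: card_1_singleton_iff)
    then have "min (Suc c) (n - 1) = n - 1" using powers[of c] zero[of c] by auto
    then show False using that by auto
  qed
  then have "nilpotency_class ?S ?g = n - 2"
    unfolding nilpotency_class_def using last by (intro Least_equality) (auto simp: not_less[symmetric])
  then show ?thesis
    using sg last n unfolding nilpotent_semigroups_def nilpotent_on_def coclass_def by auto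
qed

text \<open>Exactly \<open>0\<close> and \<open>1\<close> are not products, so \<open>h\<close>
  permutes them. If it fixes them, it fixes all powers of \<open>1\<close>, and the parameters can
  be read off the products of generators. If it exchanges them, both triples are
  \<open>(1, 1, 2)\<close>.\<close>

lemma model_rigid:
  assumes n: "n \<ge> 5" and t: "(p, q, m) \<in> params n" "(p', q', m') \<in> params n"
    and iso: "isomorphic {..<n} (model n p q m) {..<n} (model n p' q' m')"
  shows "(p, q, m) = (p', q', m')"
proof -
  let ?g = "model n p q m" and ?g' = "model n p' q' m'"
  obtain h where h: "bij_betw h {..<n} {..<n}"
    and hom: "\<And>x y. x < n \<Longrightarrow> y < n \<Longrightarrow> h (?g x y) = ?g' (h x) (h y)"
    using iso by (auto simp: isomorphic_def)
  have inj: "x = y" if "h x = h y" "x < n" "y < n" for x y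
    using h that by (auto simp: bij_betw_def dest: inj_onD)
  have hn: "h x < n" if "x < n" for x using h that by (auto dest: bij_betwE)
  note pq = paramsD[OF n t(1)] and pq' = paramsD[OF n t(2)]
  have high: "2 \<le> ?g' x y" for x y
    using pq' n by (auto simp: model_def)
  have h2: "2 \<le> h x" if "2 \<le> x" "x < n" for x
  proof -
    have "x = ?g (x - 1) 1" using that by (auto simp: model_def)
    then have "h x = ?g' (h (x - 1)) (h 1)" using hom[of "x - 1" 1] that by simp
    then show ?thesis using high by simp
  qed
  have low: "x < 2" if "h x < 2" "x < n" for x using h2[of x] that by linarith
  have "0 \<in> h ` {..<n}" "1 \<in> h ` {..<n}" using h n by (auto simp: bij_betw_def)
  then obtain u0 u1 where "h u0 = 0" "u0 < n" "h u1 = 1" "u1 < n" by auto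
  then have "h 0 = 0 \<and> h 1 = 1 \<or> h 0 = 1 \<and> h 1 = 0"
    using low[of u0] low[of u1] by (auto simp: less_2_cases_iff)
  then show ?thesis
  proof
    assume h01: "h 0 = 0 \<and> h 1 = 1"
    have hx: "h (Suc x) = Suc x" if "Suc x < n" for x
      using that
    proof (induction x)
      case (Suc x)
      have "Suc (Suc x) = ?g (Suc x) 1" using Suc.prems by (auto simp: model_def)
      then have "h (Suc (Suc x)) = ?g' (Suc x) 1" using hom[of "Suc x" 1] Suc h01 by simp
      then show ?case using Suc.prems by (auto simp: model_def)
    qed (use h01 in simp)
    have hx: "h x = x" if "x < n" for x using hx[of "x - 1"] h01 that by (cases x) auto
    have "m < n" using pq n by linarith
    then have eq: "?g x y = ?g' x y" if "x < n" "y < n" for x y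
      using hom[OF that] hx[OF model_less] hx[OF that(1)] hx[OF that(2)] by metis
    show ?thesis
      using eq[of 0 1] eq[of 1 0] eq[of 0 0] n pq(2,4) pq'(2,4) by (simp add: model_generators)
  next
    \<comment> \<open>The powers of \<open>b\<close> in the second model must then be as many as those of \<open>a\<close> in the first,
      which forces all products of generators to be \<open>a\<^sup>2\<close>.\<close>
    assume h01: "h 0 = 1 \<and> h 1 = 0"
    \<comment> \<open>Powers of \<open>a\<close> go to powers of \<open>b\<close>: the square of
      \<open>b\<close> has exponent \<open>m'\<close>, and each further factor \<open>b\<close> on
      the right adds \<open>q'\<close>.\<close>
    have hx: "h (Suc (Suc x)) = min (n - 1) (m' + x * q')" if "Suc (Suc x) < n" for x
      using that
    proof (induction x)
      case 0
      have "Suc (Suc 0) = ?g 1 1" using n by (simp add: model_def)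
      then have "h (Suc (Suc 0)) = ?g' 0 0" using hom[of 1 1] h01 n by simp
      then show ?case using pq'(6) by (simp add: model_def)
    next
      case (Suc x)
      have "Suc (Suc (Suc x)) = ?g (Suc (Suc x)) 1" using Suc.prems by (auto simp: model_def)
      then have "h (Suc (Suc (Suc x))) = ?g' (min (n - 1) (m' + x * q')) 0"
        using hom[of "Suc (Suc x)" 1] Suc h01 by simp
      also have "\<dots> = min (n - 1) (min (n - 1) (m' + x * q') + q')"
      proof -
        have "min (n - 1) (m' + x * q') \<noteq> 0" using n pq'(5) by simp
        then show ?thesis by (simp only: model_def simp_thms if_False if_True)
      qed
      also have "\<dots> = min (n - 1) (m' + x * q' + q')" by linarith
      finally show ?case by (simp add: add_ac)
    qed
    have hx: "h x = min (n - 1) (m' + (x - 2) * q')" if "2 \<le> x" "x < n" for x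
      using hx[of "x - 2"] that by (simp add: Suc_diff_Suc numeral_2_eq_2)
    \<comment> \<open>Since these two values differ, the first is not truncated; with
      \<open>m' \<ge> 2\<close> and \<open>q' \<ge> 1\<close> this leaves only \<open>m' = 2\<close>
      and \<open>q' = 1\<close>.\<close>
    have "h (n - 2) \<noteq> h (n - 1)" using inj[of "n - 2" "n - 1"] n by auto
    moreover have "h (n - 2) = min (n - 1) (m' + (n - 4) * q')"
      using hx[of "n - 2"] n by (simp add: diff_diff_eq)
    moreover have "h (n - 1) = min (n - 1) (m' + (n - 3) * q')"
      using hx[of "n - 1"] n by (simp add: diff_diff_eq numeral_3_eq_3)
    moreover have "(n - 4) * q' \<le> (n - 3) * q'" by (intro mult_right_mono) auto
    ultimately have *: "m' + (n - 4) * q' < n - 1" by linarith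
    have "(n - 4) * 1 \<le> (n - 4) * q'" using pq' by (intro mult_left_mono) auto
    then have m': "m' = 2" "(n - 4) * q' \<le> (n - 4) * 1"
      using * pq'(5) n by linarith+
    have "q' \<le> 1" using m'(2) n by (simp only: mult_le_cancel1)
    then have q': "q' = 1" using pq'(3) by simp
    have p': "p' = 1" using m'(1) pq'(8) n by linarith
    have hid: "h x = x" if "2 \<le> x" "x < n" for x
      using hx[OF that] that m'(1) q' by simp
    have g': "?g' 0 (Suc 0) = 2" "?g' (Suc 0) 0 = 2" "?g' (Suc 0) (Suc 0) = 2"
      using p' q' n by (simp_all add: model_def)
    have "h m = 2" "h (Suc p) = 2" "h (Suc q) = 2"
      using hom[of 0 0] hom[of 0 1] hom[of 1 0] g' h01 n pq(2,4) by (simp_all add: model_generators)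
    then have "m = 2" "Suc p = 2" "Suc q = 2"
      using hid[of m] hid[of "Suc p"] hid[of "Suc q"] pq(1-6) n by simp_all
    then show ?thesis using m' p' q' by simp
  qed
qed

lemma commutative_model_iff:
  assumes n: "n \<ge> 5" and t: "(p, q, m) \<in> params n"
  shows "commutative_on {..<n} (model n p q m) \<longleftrightarrow> p = q"
proof
  assume "commutative_on {..<n} (model n p q m)"
  then have "model n p q m 0 1 = model n p q m 1 0" using n by (auto simp: commutative_on_def)
  then have "min (n - 1) (p + 1) = min (n - 1) (1 + q)" by (simp add: model_def)
  \<comment> \<open>Truncation loses nothing, as \<open>p + 1\<close> and \<open>q + 1\<close> are
    at most \<open>n - 1\<close>.\<close>
  then show "p = q" using paramsD(1-4)[OF n t] by linarith
next
  assume "p = q"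
  then show "commutative_on {..<n} (model n p q m)"
    by (auto simp: commutative_on_def model_def add.commute)
qed

lemma commutative_on_isomorphic:
  assumes "isomorphic S f T g" "commutative_on S f"
  shows "commutative_on T g"
proof -
  obtain h where h: "bij_betw h S T" "\<And>x y. x \<in> S \<Longrightarrow> y \<in> S \<Longrightarrow> h (f x y) = g (h x) (h y)"
    using assms(1) by (auto simp: isomorphic_def)
  have "T = h ` S" using h by (simp add: bij_betw_def)
  then show ?thesis using assms(2) h(2) unfolding commutative_on_def by (metis imageE)
qed

lemma nilpotent_semigroups_iso_model:
  assumes "n \<ge> 5" "f \<in> nilpotent_semigroups n 1"
  obtains p q m where "(p, q, m) \<in> params n" "isomorphic {..<n} f {..<n} (model n p q m)"
proof -
  have f: "semigroup_on {..<n} f" "nilpotent_on {..<n} f" "coclass {..<n} f = 1"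
    using assms by (auto simp: nilpotent_semigroups_def)
  interpret coclass_one_semigroup "{..<n}" f n
    using f assms(1) by unfold_locales auto
  obtain p q m where t: "(p, q, m) \<in> params n" "isomorphic {..<n} (model n p q m) {..<n} f"
    using classification by blast
  then have "semigroup_on {..<n} (model n p q m)"
    using model_nilpotent assms(1) by (auto simp: nilpotent_semigroups_def)
  then show thesis using that t isomorphic_sym by blast
qed

subsection \<open>Counting\<close>

text \<open>For \<open>p = q\<close>, the exponent \<open>m\<close> must be \<open>2 * p\<close>
  when this is below \<open>n - 2\<close>; otherwise both \<open>n - 2\<close> and
  \<open>n - 1\<close> are possible.\<close>

lemma card_commutative_params:
  assumes "n \<ge> 5"
  shows "card {(p, q, m) \<in> params n. p = q} = n + n div 2 - 2"
proof -
  let ?B = "\<lambda>p. {m. m \<le> n - 1 \<and> min m (n - 2) = min (2 * p) (n - 2)}"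
  have "bij_betw (\<lambda>(p, m). (p, p, m)) (SIGMA p:{1..n - 2}. ?B p) {(p, q, m) \<in> params n. p = q}"
    by (auto simp: bij_betw_def inj_on_def params_def image_iff)
  then have "card {(p, q, m) \<in> params n. p = q} = card (SIGMA p:{1..n - 2}. ?B p)"
    by (simp add: bij_betw_same_card)
  also have "\<dots> = (\<Sum>p=1..n - 2. card (?B p))" by simp
  also have "\<dots> = (\<Sum>p=1..n - 2. if 2 * p < n - 2 then 1 else 2)"
  proof (rule sum.cong)
    fix p assume "p \<in> {1..n - 2}"
    have "?B p = (if 2 * p < n - 2 then {2 * p} else {n - 2, n - 1})"
      using assms unfolding min_eq_min_iff by auto
    then show "card (?B p) = (if 2 * p < n - 2 then 1 else 2)"
      using assms by simp
  qed simp
  also have "\<dots> = n + n div 2 - 2"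
  proof -
    have "{p \<in> {1..n - 2}. 2 * p < n - 2} = {1..(n - 3) div 2}"
      "{p \<in> {1..n - 2}. \<not> 2 * p < n - 2} = {Suc ((n - 3) div 2)..n - 2}"
      using assms by auto
    then have "(\<Sum>p=1..n - 2. if 2 * p < n - 2 then 1 else 2 :: nat) =
        (n - 3) div 2 + 2 * (n - 2 - (n - 3) div 2)"
      by (simp add: sum.If_cases Int_def Collect_neg_eq)
    \<comment> \<open>Splitting by the parity of \<open>n\<close> evaluates the divisions.\<close>
    moreover have "n = 2 * ((n - 5) div 2) + 5 \<or> n = 2 * ((n - 5) div 2) + 6"
      using assms by linarith
    then obtain k where "n = 2 * k + 5 \<or> n = 2 * k + 6" by blast
    then have "(n - 3) div 2 + 2 * (n - 2 - (n - 3) div 2) = n + n div 2 - 2" by auto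
    ultimately show ?thesis by simp
  qed
  finally show ?thesis .
qed

text \<open>Distinct \<open>p\<close> and \<open>q\<close> agree after truncation at
  \<open>n - 3\<close> only if they are \<open>n - 3\<close> and \<open>n - 2\<close>. Then
  \<open>2 * p\<close> reaches \<open>n - 2\<close>, which leaves two values for
  \<open>m\<close>.\<close>

lemma noncommutative_params:
  assumes n: "n \<ge> 5"
  shows "{(p, q, m) \<in> params n. p < q} = {(n - 3, n - 2, n - 2), (n - 3, n - 2, n - 1)}"
    and "{(p, q, m) \<in> params n. q < p} = {(n - 2, n - 3, n - 2), (n - 2, n - 3, n - 1)}"
proof -
  have "p = n - 3 \<and> q = n - 2 \<and> (m = n - 2 \<or> m = n - 1)"
    if t: "(p, q, m) \<in> params n" and "p < q" for p q m
  proof -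
    note t = paramsD[OF n t]
    have "n - 3 \<le> p" using t(7) \<open>p < q\<close> unfolding min_eq_min_iff by simp
    then have p: "p = n - 3" and q: "q = n - 2" using \<open>p < q\<close> t(4) by linarith+
    have "n - 2 \<le> 2 * p" using p n by simp
    then have "n - 2 \<le> m" using t(8) by linarith
    then show ?thesis using p q t(6) by linarith
  qed
  moreover have "(n - 3, n - 2, n - 2) \<in> params n" "(n - 3, n - 2, n - 1) \<in> params n" "n - 3 < n - 2"
  proof -
    have "1 \<le> n - 3" "1 \<le> n - 2" "n - 3 \<le> n - 2" "n - 2 \<le> n - 1" "n - 2 \<le> 2 * (n - 3)" "n - 3 < n - 2"
      using n by linarith+
    then show "(n - 3, n - 2, n - 2) \<in> params n" "(n - 3, n - 2, n - 1) \<in> params n" "n - 3 < n - 2"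
      unfolding params_def min_eq_min_iff by blast+
  qed
  ultimately show less: "{(p, q, m) \<in> params n. p < q} = {(n - 3, n - 2, n - 2), (n - 3, n - 2, n - 1)}"
    by blast
  have "{(p, q, m) \<in> params n. q < p} = (\<lambda>(p, q, m). (q, p, m)) ` {(p, q, m) \<in> params n. p < q}"
    using params_swap[OF n] by (auto simp: image_iff)
  then show "{(p, q, m) \<in> params n. q < p} = {(n - 2, n - 3, n - 2), (n - 2, n - 3, n - 1)}"
    by (simp add: less)
qed

lemma finite_params: "finite (params n)"
  by (rule finite_subset[of _ "{..n - 2} \<times> {..n - 2} \<times> {..n - 1}"]) (auto simp: params_def)

theorem corollary5p1:
  fixes n :: nat
  assumes "n \<ge> 5"
  shows "number_up_to (iso_anti_rel n) (nilpotent_semigroups n 1) = n + n div 2 \<and>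
    number_up_to (iso_rel n) (nilpotent_semigroups n 1) = n + n div 2 + 2 \<and>
    number_up_to (iso_rel n) {f \<in> nilpotent_semigroups n 1. commutative_on {..<n} f}
      = n + n div 2 - 2"
proof (intro conjI)
  let ?m = "\<lambda>(p, q, m). model n p q m" and ?N = "nilpotent_semigroups n 1"
  let ?E = "{(p, q, m) \<in> params n. p = q}" and ?L = "{(p, q, m) \<in> params n. p < q}"
    and ?G = "{(p, q, m) \<in> params n. q < p}"
  have N: "?N \<subseteq> {f. semigroup_on {..<n} f}" by (auto simp: nilpotent_semigroups_def)
  have finite: "finite ?E" "finite ?L" "finite ?G"
    by (auto intro: finite_subset[OF _ finite_params])
  have card: "card ?E = n + n div 2 - 2" "card ?L = 2" "card ?G = 2"
    using assms by (simp_all add: card_commutative_params noncommutative_params)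
  have model: "?m t \<in> ?N" if "t \<in> params n" for t
    using model_nilpotent assms that by (cases t) auto
  have sg: "semigroup_on {..<n} (?m t)" if "t \<in> params n" for t
    using model[OF that] N by blast
  have rigid: "t = t'" if "t \<in> params n" "t' \<in> params n" "(?m t, ?m t') \<in> iso_rel n" for t t'
    using model_rigid assms that by (cases t; cases t') (auto simp: iso_rel_def)
  have cover: "\<exists>t\<in>params n. (f, ?m t) \<in> iso_rel n" if f: "f \<in> ?N" for f
  proof -
    obtain p q m where "(p, q, m) \<in> params n" "isomorphic {..<n} f {..<n} (model n p q m)"
      by (rule nilpotent_semigroups_iso_model[OF assms f])
    then show ?thesis
      using f N sg[of "(p, q, m)"] by (intro bexI[of _ "(p, q, m)"]) (auto simp: iso_rel_def)
  qed

  show "number_up_to (iso_rel n) ?N = n + n div 2 + 2"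
  proof -
    have "card (?N // iso_rel n) = card (params n)"
      using model by (intro card_quotient_representatives[OF equiv_iso_rel N _ rigid cover]) auto
    also have "params n = ?E \<union> (?L \<union> ?G)" by auto
    also have "card \<dots> = card ?E + (card ?L + card ?G)"
      using finite by (subst card_Un_disjoint; (subst card_Un_disjoint)?) auto
    finally show ?thesis using card assms by (simp add: number_up_to_def)
  qed

  show "number_up_to (iso_rel n) {f \<in> ?N. commutative_on {..<n} f} = n + n div 2 - 2"
  proof -
    let ?C = "{f \<in> ?N. commutative_on {..<n} f}"
    have "card (?C // iso_rel n) = card ?E"
    proof (rule card_quotient_representatives[OF equiv_iso_rel])
      show "?C \<subseteq> {f. semigroup_on {..<n} f}" using N by auto
      show "?m ` ?E \<subseteq> ?C"
        using model_nilpotent commutative_model_iff assms by auto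
      show "t = t'" if "t \<in> ?E" "t' \<in> ?E" "(?m t, ?m t') \<in> iso_rel n" for t t'
        using rigid that by blast
      show "\<exists>t\<in>?E. (f, ?m t) \<in> iso_rel n" if f: "f \<in> ?C" for f
      proof -
        obtain p q m where t: "(p, q, m) \<in> params n" "(f, model n p q m) \<in> iso_rel n"
          using cover[of f] f by (auto split: prod.splits)
        then have "commutative_on {..<n} (model n p q m)"
          using commutative_on_isomorphic f by (auto simp: iso_rel_def)
        then have "p = q" using commutative_model_iff assms t by blast
        then show ?thesis using t by (intro bexI[of _ "(p, q, m)"]) auto
      qed
    qed
    then show ?thesis using card by (simp add: number_up_to_def)
  qed

  \<comment> \<open>Duality exchanges \<open>p\<close> and \<open>q\<close>, so the triples with
    \<open>p \<le> q\<close> represent all classes.\<close>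
  show "number_up_to (iso_anti_rel n) ?N = n + n div 2"
  proof -
    have "card (?N // iso_anti_rel n) = card (?E \<union> ?L)"
    proof (rule card_quotient_representatives[OF equiv_iso_anti_rel N])
      show "?m ` (?E \<union> ?L) \<subseteq> ?N" using model by auto
      show "t = t'" if t: "t \<in> ?E \<union> ?L" "t' \<in> ?E \<union> ?L" "(?m t, ?m t') \<in> iso_anti_rel n" for t t'
      proof -
        obtain p q m where pq: "t = (p, q, m)" "t \<in> params n" "p \<le> q" using t(1) by auto
        obtain p' q' m' where pq': "t' = (p', q', m')" "t' \<in> params n" "p' \<le> q'" using t(2) by auto
        have swap: "(q', p', m') \<in> params n" using pq' params_swap[OF assms] by simp
        have "(?m t, ?m t') \<in> iso_rel n \<or> (?m t, ?m (q', p', m')) \<in> iso_rel n"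
          using t(3) sg[OF swap] pq' by (auto simp: iso_anti_rel_def iso_rel_def anti_isomorphic_def dual_model)
        then have "t = t' \<or> t = (q', p', m')" using rigid pq(2) pq'(2) swap by blast
        \<comment> \<open>In the swapped case \<open>p \<le> q\<close> and
          \<open>p' \<le> q'\<close> force all four exponents to be equal.\<close>
        then show ?thesis using pq pq' by auto
      qed
      show "\<exists>t\<in>?E \<union> ?L. (f, ?m t) \<in> iso_anti_rel n" if f: "f \<in> ?N" for f
      proof -
        obtain p q m where t: "(p, q, m) \<in> params n" "(f, model n p q m) \<in> iso_rel n"
          using cover[OF f] by (auto split: prod.splits)
        show ?thesis
        proof (cases "p \<le> q")
          case True
          then show ?thesis using t
            by (intro bexI[of _ "(p, q, m)"]) (auto simp: iso_rel_def iso_anti_rel_def)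
        next
          case False
          have "(q, p, m) \<in> params n" using t(1) params_swap[OF assms] by simp
          then show ?thesis using t False sg[of "(q, p, m)"]
            by (intro bexI[of _ "(q, p, m)"])
              (auto simp: iso_rel_def iso_anti_rel_def anti_isomorphic_def dual_model)
        qed
      qed
    qed
    also have "\<dots> = card ?E + card ?L" using finite by (intro card_Un_disjoint) auto
    finally show ?thesis using card assms by (simp add: number_up_to_def)
  qed
qed

end
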